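(* Let $b$ be a locally finite, connected graph over a discrete measure space $(X,m)$ that satisfies the ellipticity condition (EC), i.e. there is a constant $C>0$ such that $b(x,y)\le C\,m(x)m(y)$ for all $x,y\in X$, and that satisfies $CD(K,\infty)$ for some $K>0$. Assume furthermore that the graph is complete. Then the graph has finite measure, i.e. $m(X)<\infty$.
   Context: $X$ is a countable discrete set and $m:X\to(0,\infty)$, extended to a measure by $m(A)=\sum_{x\in A}m(x)$; $(X,m)$ is called a discrete measure space. A locally finite graph over $(X,m)$ is a symmetric function $b:X\times X\to[0,\infty)$ with zero diagonal such that $\{y\in X: b(x,y)>0\}$ is finite for every $x\in X$. It is connected if any two vertices $x,y\in X$ are joined by a path $x=x_0,x_1,\dots,x_N=y$ with $b(x_{i-1},x_i)>0$ for $i=1,\dots,N$. $C(X)$ denotes all real-valued functions on $X$ and $C_c(X)$ the finitely supported ones. The Laplacian on $C(X)$ is $\Delta f(x)=\frac{1}{m(x)}\sum_{y\in X}b(x,y)(f(y)-f(x))$. Set $\Gamma_0(f,g)=fg$ and iteratively $2\Gamma_{k+1}(f,g)=\Delta\Gamma_k(f,g)-\Gamma_k(f,\Delta g)-\Gamma_k(\Delta f,g)$ for $f,g\in C(X)$, $k\ge 0$; write $\Gamma_k(f)=\Gamma_k(f,f)$ and $\Gamma=\Gamma_1$. The graph satisfies $CD(K,\infty)$, $K\in\mathbb{R}$, if $\Gamma_2(f)\ge K\,\Gamma(f)$ pointwise on $X$ for all $f\in C(X)$. The graph is complete if there is an increasing sequence of nonnegative functions $\eta_k\in C_c(X)$,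 $k\in\mathbb{N}$, with $\eta_k\to1$ pointwise and $\Gamma(\eta_k)\to0$ uniformly on $X$, i.e. $\|\Gamma(\eta_k)\|_\infty\to0$, as $k\to\infty$. *)

theory Defs
  imports "HOL-Analysis.Analysis"
begin

text \<open>
  The countable discrete set \<open>X\<close> is the universe of a type \<open>'a\<close> of class
  \<open>countable\<close>; finite and countably infinite \<open>X\<close> are both covered. Then \<open>C(X)\<close> is the
  type \<open>'a \<Rightarrow> real\<close>.
\<close>

definition discrete_measure_space :: "('a::countable \<Rightarrow> real) \<Rightarrow> bool" where
  "discrete_measure_space m \<longleftrightarrow> (\<forall>x. m x > 0)"

text \<open>
  The extension of \<open>m\<close> to all subsets of \<open>X\<close>, with values in \<open>[0,\<infinity>]\<close>:
  \<open>m(A) = \<Sum>x\<in>A. m(x)\<close> is \<open>emeasure (vertex_measure m) A\<close>.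
\<close>

definition vertex_measure :: "('a::countable \<Rightarrow> real) \<Rightarrow> 'a measure" where
  "vertex_measure m = point_measure UNIV (\<lambda>x. ennreal (m x))"

definition locally_finite_graph :: "('a::countable \<Rightarrow> 'a \<Rightarrow> real) \<Rightarrow> bool" where
  "locally_finite_graph b \<longleftrightarrow>
     (\<forall>x y. b x y \<ge> 0) \<and>
     (\<forall>x y. b x y = b y x) \<and>
     (\<forall>x. b x x = 0) \<and>
     (\<forall>x. finite {y. b x y > 0})"

definition connected_graph :: "('a::countable \<Rightarrow> 'a \<Rightarrow> real) \<Rightarrow> bool" where
  "connected_graph b \<longleftrightarrow>
     (\<forall>x y. \<exists>(N::nat) p. p 0 = x \<and> p N = y \<and> (\<forall>i\<in>{1..N}. b (p (i - 1)) (p i) > 0))"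

text \<open>
  The sum runs over the neighbours of \<open>x\<close> only: for a locally finite graph this is a finite
  sum and the omitted terms all vanish, whereas \<open>sum\<close> over an infinite \<open>X\<close> would be
  \<open>0\<close> by convention.
\<close>

definition laplacian ::
  "('a::countable \<Rightarrow> real) \<Rightarrow> ('a \<Rightarrow> 'a \<Rightarrow> real) \<Rightarrow> ('a \<Rightarrow> real) \<Rightarrow> 'a \<Rightarrow> real" where
  "laplacian m b f x = 1 / m x * (\<Sum>y | b x y > 0. b x y * (f y - f x))"

primrec Gamma_iter ::
  "('a::countable \<Rightarrow> real) \<Rightarrow> ('a \<Rightarrow> 'a \<Rightarrow> real) \<Rightarrow> nat \<Rightarrow>
   ('a \<Rightarrow> real) \<Rightarrow> ('a \<Rightarrow> real) \<Rightarrow> 'a \<Rightarrow> real" where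
  "Gamma_iter m b 0 = (\<lambda>f g x. f x * g x)"
| "Gamma_iter m b (Suc k) = (\<lambda>f g x.
     (laplacian m b (Gamma_iter m b k f g) x
       - Gamma_iter m b k f (laplacian m b g) x
       - Gamma_iter m b k (laplacian m b f) g x) / 2)"

definition satisfies_CD_infinity ::
  "('a::countable \<Rightarrow> real) \<Rightarrow> ('a \<Rightarrow> 'a \<Rightarrow> real) \<Rightarrow> real \<Rightarrow> bool" where
  "satisfies_CD_infinity m b K \<longleftrightarrow>
     (\<forall>f x. Gamma_iter m b 2 f f x \<ge> K * Gamma_iter m b 1 f f x)"

definition elliptic :: "('a::countable \<Rightarrow> real) \<Rightarrow> ('a \<Rightarrow> 'a \<Rightarrow> real) \<Rightarrow> bool" where
  "elliptic m b \<longleftrightarrow> (\<exists>C>0. \<forall>x y. b x y \<le> C * m x * m y)"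

text \<open>\<open>incseq\<close> refers to the pointwise order on functions.\<close>

definition complete_graph :: "('a::countable \<Rightarrow> real) \<Rightarrow> ('a \<Rightarrow> 'a \<Rightarrow> real) \<Rightarrow> bool" where
  "complete_graph m b \<longleftrightarrow>
     (\<exists>\<eta> :: nat \<Rightarrow> 'a \<Rightarrow> real.
        incseq \<eta> \<and>
        (\<forall>k x. \<eta> k x \<ge> 0) \<and>
        (\<forall>k. finite {x. \<eta> k x \<noteq> 0}) \<and>
        (\<forall>x. (\<lambda>k. \<eta> k x) \<longlonglongrightarrow> 1) \<and>
        uniform_limit UNIV (\<lambda>k. Gamma_iter m b 1 (\<eta> k) (\<eta> k)) (\<lambda>x. 0) sequentially)"

end

theory Submission
  imports Defs
begin

text \<open>
  Fix a cutoff \<open>f = \<eta>\<^sub>k\<close> and, for \<open>\<alpha> > 0\<close>, let \<open>u\<close> be the minimal solution of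
  \<open>\<alpha> u - \<Delta> u = f\<close>. It satisfies \<open>0 \<le> \<alpha> u \<le> 1\<close>, it has finite energy, and
  \<open>\<alpha>\<^sup>2 \<parallel>u\<parallel>\<^sup>2 \<le> \<Sum> m f\<close>. By the curvature condition \<open>w = \<Gamma>(u)\<close> satisfies
  \<open>\<Delta> w \<ge> K w - G / K\<close>, where \<open>G = \<parallel>\<Gamma>(f)\<parallel>\<^sub>\<infinity>\<close>, so \<open>v = max 0 (w - G / K\<^sup>2)\<close> is
  an integrable function with \<open>\<Delta> v \<ge> K v\<close>. Ellipticity bounds \<open>\<Delta> v\<close>, hence \<open>v\<close>, by a
  multiple of the \<open>L\<^sup>1\<close> norm of \<open>v\<close>; thus \<open>v\<close> is square integrable, and completeness forces
  \<open>v = 0\<close>. The resulting bound \<open>\<Gamma>(u) \<le> G / K\<^sup>2\<close> does not depend on \<open>\<alpha>\<close> and is small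
  for large \<open>k\<close>. Evaluating the equation at a vertex \<open>z\<close> therefore bounds \<open>\<alpha> u(z)\<close> away from
  \<open>0\<close>, while the oscillation of \<open>\<alpha> u\<close> along each edge tends to \<open>0\<close> as \<open>\<alpha> \<rightarrow> 0\<close>. So
  \<open>\<alpha>\<^sup>2 \<parallel>u\<parallel>\<^sup>2 \<le> \<Sum> m f\<close> bounds the measure of all finite sets.
\<close>

declare Gamma_iter.simps(2) [simp del]

section \<open>Laplacian and carre du champ of a weighted graph\<close>

locale weighted_graph =
  fixes m :: "'a::countable \<Rightarrow> real" and b :: "'a \<Rightarrow> 'a \<Rightarrow> real"
  assumes m_pos: "m x > 0"
    and b_nonneg: "b x y \<ge> 0"
    and b_sym: "b x y = b y x"
    and finite_nbrs: "finite {y. b x y > 0}"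
begin

abbreviation "Lap \<equiv> laplacian m b"
abbreviation "Gam \<equiv> Gamma_iter m b (Suc 0)"
abbreviation "nbrs x \<equiv> {y. b x y > 0}"

definition deg :: "'a \<Rightarrow> real" where
  "deg x = (\<Sum>y\<in>nbrs x. b x y)"

lemma m_nonneg: "m x \<ge> 0"
  using m_pos[of x] by simp

lemma deg_nonneg: "deg x \<ge> 0"
  unfolding deg_def by (intro sum_nonneg b_nonneg)

text \<open>Weights vanish off the neighbourhood. Replacing all neighbourhoods by one finite set
  \<open>S\<close> is what allows double sums to be symmetrised.\<close>

lemma sum_nbrs_eq:
  assumes "finite S" "nbrs x \<subseteq> S"
  shows "(\<Sum>y\<in>nbrs x. b x y * F y) = (\<Sum>y\<in>S. b x y * F y)"
proof (rule sum.mono_neutral_left[OF assms])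
  show "\<forall>y\<in>S - nbrs x. b x y * F y = 0"
    using b_nonneg[of x] by (auto simp: not_less intro: antisym)
qed

lemma mult_Lap: "m x * Lap f x = (\<Sum>y\<in>nbrs x. b x y * (f y - f x))"
  using m_pos[of x] by (simp add: laplacian_def)

lemma mult_Lap_deg: "m x * Lap f x = (\<Sum>y\<in>nbrs x. b x y * f y) - deg x * f x"
  unfolding mult_Lap deg_def by (simp add: right_diff_distrib sum_subtractf sum_distrib_right)

text \<open>Discrete product rule: on each edge, the defect of the Leibniz rule for
  \<open>f * g\<close> is the product of the two increments.\<close>

lemma mult_Gam:
  "2 * m x * Gam f g x = (\<Sum>y\<in>nbrs x. b x y * ((f y - f x) * (g y - g x)))"
proof -
  have "2 * m x * Gam f g x =
      m x * Lap (\<lambda>x. f x * g x) x - f x * (m x * Lap g x) - (m x * Lap f x) * g x"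
    by (simp add: Gamma_iter.simps(2) field_simps)
  also have "\<dots> = (\<Sum>y\<in>nbrs x. b x y * ((f y - f x) * (g y - g x)))"
    unfolding mult_Lap sum_distrib_left sum_distrib_right sum_subtractf[symmetric]
    by (rule sum.cong) (auto simp: algebra_simps)
  finally show ?thesis .
qed

lemma Gam_nonneg: "Gam f f x \<ge> 0"
proof -
  have "0 \<le> 2 * m x * Gam f f x"
    unfolding mult_Gam by (intro sum_nonneg mult_nonneg_nonneg[OF b_nonneg] zero_le_square)
  then show ?thesis using m_pos[of x] by (simp add: zero_le_mult_iff)
qed

text \<open>Shaped for substituting the resolvent equation into the curvature inequality.\<close>

lemma Gam_linear_right:
  "Gam f (\<lambda>x. c * g x - h x) x = c * Gam f g x - Gam f h x"
proof -
  have "2 * m x * Gam f (\<lambda>x. c * g x - h x) x =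
      c * (2 * m x * Gam f g x) - 2 * m x * Gam f h x"
    unfolding mult_Gam sum_distrib_left sum_subtractf[symmetric]
    by (rule sum.cong) (auto simp: algebra_simps)
  also have "\<dots> = 2 * m x * (c * Gam f g x - Gam f h x)" by (simp only: algebra_simps)
  finally show ?thesis using m_pos[of x] by simp
qed

lemma Gam_sym: "Gam f g x = Gam g f x"
proof -
  have "2 * m x * Gam f g x = 2 * m x * Gam g f x"
    unfolding mult_Gam by (simp add: mult.commute)
  then show ?thesis using m_pos[of x] by simp
qed

text \<open>Young's inequality on each edge. With \<open>c = K\<close> it will spend half of the
  curvature gain \<open>2 * K\<close> on a cross term.\<close>

lemma Gam_young:
  assumes "c > 0"
  shows "2 * Gam f g x \<le> c * Gam f f x + Gam g g x / c"
proof -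
  have young: "2 * (p * q) \<le> c * (p * p) + q * q / c" for p q :: real
  proof -
    have "0 \<le> (c * p - q)\<^sup>2 / c" using assms by simp
    also have "\<dots> = c * (p * p) + q * q / c - 2 * (p * q)"
      using assms by (simp add: power2_eq_square field_simps)
    finally show ?thesis by simp
  qed
  have "2 * (2 * m x * Gam f g x)
      \<le> c * (2 * m x * Gam f f x) + (2 * m x * Gam g g x) / c"
    unfolding mult_Gam sum_distrib_left sum_divide_distrib sum.distrib[symmetric]
  proof (rule sum_mono)
    fix y
    show "2 * (b x y * ((f y - f x) * (g y - g x)))
        \<le> c * (b x y * ((f y - f x) * (f y - f x))) + b x y * ((g y - g x) * (g y - g x)) / c"
      using mult_left_mono[OF young[of "f y - f x" "g y - g x"] b_nonneg[of x y]]
      by (simp add: algebra_simps)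
  qed
  then have "2 * m x * (2 * Gam f g x) \<le> 2 * m x * (c * Gam f f x + Gam g g x / c)"
    by (simp add: algebra_simps)
  then show ?thesis using m_pos[of x] by simp
qed

lemma Gam_ge_edge: "b x y * (f y - f x)\<^sup>2 \<le> 2 * m x * Gam f f x"
proof (cases "b x y > 0")
  case True
  have "(\<lambda>y. b x y * ((f y - f x) * (f y - f x))) y
      \<le> (\<Sum>y\<in>nbrs x. b x y * ((f y - f x) * (f y - f x)))"
    by (rule member_le_sum) (use True b_nonneg finite_nbrs in auto)
  then show ?thesis by (simp only: mult_Gam power2_eq_square)
next
  case False
  then show ?thesis using m_pos[of x] Gam_nonneg[of f x] b_nonneg[of x y] by (simp add: not_less)
qed

text \<open>Cauchy-Schwarz with each weight split into two square roots: one factor sums to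
  \<open>deg x\<close>, the other to \<open>2 * m x * Gam f f x\<close>.\<close>

lemma Lap_square_le: "m x * (Lap f x)\<^sup>2 \<le> 2 * deg x * Gam f f x"
proof -
  have "(m x * Lap f x)\<^sup>2 = (\<Sum>y\<in>nbrs x. sqrt (b x y) * (sqrt (b x y) * (f y - f x)))\<^sup>2"
    unfolding mult_Lap by (simp add: mult.assoc[symmetric] b_nonneg)
  also have "\<dots> \<le> (\<Sum>y\<in>nbrs x. (sqrt (b x y))\<^sup>2) * (\<Sum>y\<in>nbrs x. (sqrt (b x y) * (f y - f x))\<^sup>2)"
    by (rule Cauchy_Schwarz_ineq_sum)
  also have "\<dots> = deg x * (2 * m x * Gam f f x)"
    unfolding deg_def mult_Gam by (simp add: power_mult_distrib b_nonneg power2_eq_square[of "f _ - f _"])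
  finally have "m x * (m x * (Lap f x)\<^sup>2) \<le> m x * (2 * deg x * Gam f f x)"
    by (simp add: power2_eq_square algebra_simps)
  then show ?thesis using m_pos[of x] by simp
qed

section \<open>Green's formula and vanishing of subsolutions\<close>

text \<open>Exchanging \<open>x\<close> and \<open>y\<close> and using the symmetry of
  \<open>b\<close> gives \<open>A = - B\<close>, while the double sum of products of increments is
  \<open>B - A\<close>.\<close>

lemma green_sum:
  assumes "finite S"
  shows "(\<Sum>x\<in>S. \<phi> x * (\<Sum>y\<in>S. b x y * (v y - v x))) =
    - (\<Sum>x\<in>S. \<Sum>y\<in>S. b x y * ((\<phi> y - \<phi> x) * (v y - v x))) / 2"
proof -
  define A where "A = (\<Sum>x\<in>S. \<Sum>y\<in>S. b x y * (\<phi> x * (v y - v x)))"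
  define B where "B = (\<Sum>x\<in>S. \<Sum>y\<in>S. b x y * (\<phi> y * (v y - v x)))"
  have "A = (\<Sum>x\<in>S. \<Sum>y\<in>S. b y x * (\<phi> y * (v x - v y)))"
    unfolding A_def by (rule sum.swap)
  also have "\<dots> = - B"
    unfolding B_def sum_negf[symmetric]
    by (intro sum.cong refl, subst b_sym) (simp add: algebra_simps)
  finally have "A = - B" .
  moreover have "(\<Sum>x\<in>S. \<Sum>y\<in>S. b x y * ((\<phi> y - \<phi> x) * (v y - v x))) = B - A"
    unfolding A_def B_def sum_subtractf[symmetric]
    by (intro sum.cong refl) (simp add: algebra_simps)
  moreover have "(\<Sum>x\<in>S. \<phi> x * (\<Sum>y\<in>S. b x y * (v y - v x))) = A"
    unfolding A_def sum_distrib_left by (intro sum.cong refl) (simp add: algebra_simps)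
  ultimately show ?thesis by simp
qed

text \<open>Wherever \<open>\<phi>\<close> is nonzero, the Laplacian of \<open>v\<close> only sees
  \<open>S\<close>; thus \<open>v\<close> may have infinite support.\<close>

lemma green:
  assumes "finite S" "\<And>x. \<phi> x \<noteq> 0 \<Longrightarrow> x \<in> S \<and> nbrs x \<subseteq> S"
  shows "(\<Sum>x\<in>S. m x * (\<phi> x * Lap v x)) =
    - (\<Sum>x\<in>S. \<Sum>y\<in>S. b x y * ((\<phi> y - \<phi> x) * (v y - v x))) / 2"
proof -
  have "m x * (\<phi> x * Lap v x) = \<phi> x * (\<Sum>y\<in>S. b x y * (v y - v x))" for x
  proof (cases "\<phi> x = 0")
    case False
    have "m x * (\<phi> x * Lap v x) = \<phi> x * (m x * Lap v x)" by simp
    also have "\<dots> = \<phi> x * (\<Sum>y\<in>S. b x y * (v y - v x))"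
      unfolding mult_Lap using sum_nbrs_eq[of S x] assms False by auto
    finally show ?thesis .
  qed simp
  then show ?thesis using green_sum[OF assms(1), of \<phi> v] by (simp only:)
qed

text \<open>
  The increment \<open>(\<eta>\<^sup>2 v)(y) - (\<eta>\<^sup>2 v)(x)\<close> times \<open>v(y) - v(x)\<close> equals
  \<open>((\<eta> v)(y) - (\<eta> v)(x))\<^sup>2 - v(x) v(y) (\<eta>(y) - \<eta>(x))\<^sup>2\<close>.
\<close>

lemma caccioppoli:
  assumes "c \<ge> 0" "\<And>x. v x \<ge> 0" "\<And>x. Lap v x \<ge> c * v x"
    and "finite {x. \<eta> x \<noteq> 0}" "\<And>x. Gam \<eta> \<eta> x \<le> \<epsilon>"
    and "\<And>F. finite F \<Longrightarrow> (\<Sum>x\<in>F. m x * (v x)\<^sup>2) \<le> M"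
  shows "c * (m x * (\<eta> x * v x)\<^sup>2) \<le> \<epsilon> * M"
proof -
  \<comment> \<open>The support of \<open>\<eta>\<close> with its neighbours is what
    \<open>green\<close> requires; \<open>x\<close> is added so that its term occurs even if
    \<open>\<eta> x = 0\<close>.\<close>
  define S where "S = {x. \<eta> x \<noteq> 0} \<union> (\<Union>x\<in>{x. \<eta> x \<noteq> 0}. nbrs x) \<union> {x}"
  have S: "finite S" using assms(4) finite_nbrs by (auto simp: S_def)
  have xS: "x \<in> S" by (simp add: S_def)
  have eps: "\<epsilon> \<ge> 0" using assms(5)[of x] Gam_nonneg[of \<eta> x] by simp
  have "c * (m x * (\<eta> x * v x)\<^sup>2) \<le> (\<Sum>x\<in>S. c * (m x * (\<eta> x * v x)\<^sup>2))"
    by (rule member_le_sum[of x S "\<lambda>x. c * (m x * (\<eta> x * v x)\<^sup>2)"])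
      (use xS S assms(1) m_nonneg in auto)
  also have "\<dots> \<le> (\<Sum>x\<in>S. m x * (((\<eta> x)\<^sup>2 * v x) * Lap v x))"
  proof (rule sum_mono)
    fix x
    have "m x * ((\<eta> x)\<^sup>2 * v x) * (c * v x) \<le> m x * ((\<eta> x)\<^sup>2 * v x) * Lap v x"
      using assms m_pos[of x] by (intro mult_left_mono) auto
    then show "c * (m x * (\<eta> x * v x)\<^sup>2) \<le> m x * (((\<eta> x)\<^sup>2 * v x) * Lap v x)"
      by (simp add: power2_eq_square algebra_simps)
  qed
  also have "\<dots> = (\<Sum>x\<in>S. \<Sum>y\<in>S.
      - (b x y * (((\<eta> y)\<^sup>2 * v y - (\<eta> x)\<^sup>2 * v x) * (v y - v x)))) / 2"
    by (subst green[OF S]) (auto simp: S_def sum_negf)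
  also have "\<dots> \<le> (\<Sum>x\<in>S. \<Sum>y\<in>S. b x y * ((\<eta> y - \<eta> x)\<^sup>2 * (((v x)\<^sup>2 + (v y)\<^sup>2) / 2))) / 2"
  proof (intro divide_right_mono sum_mono)
    fix x y
    have "- (((\<eta> y)\<^sup>2 * v y - (\<eta> x)\<^sup>2 * v x) * (v y - v x)) =
        (\<eta> y - \<eta> x)\<^sup>2 * (v x * v y) - (\<eta> y * v y - \<eta> x * v x)\<^sup>2"
      by (simp add: power2_eq_square algebra_simps)
    also have "\<dots> \<le> (\<eta> y - \<eta> x)\<^sup>2 * (v x * v y)" by simp
    also have "\<dots> \<le> (\<eta> y - \<eta> x)\<^sup>2 * (((v x)\<^sup>2 + (v y)\<^sup>2) / 2)"
      using sum_squares_bound[of "v x" "v y"] by (intro mult_left_mono) auto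
    finally show "- (b x y * (((\<eta> y)\<^sup>2 * v y - (\<eta> x)\<^sup>2 * v x) * (v y - v x)))
        \<le> b x y * ((\<eta> y - \<eta> x)\<^sup>2 * (((v x)\<^sup>2 + (v y)\<^sup>2) / 2))"
      using mult_left_mono[OF _ b_nonneg[of x y]] by fastforce
  qed simp
  also have "\<dots> = ((\<Sum>x\<in>S. \<Sum>y\<in>S. b x y * ((\<eta> y - \<eta> x)\<^sup>2 * (v x)\<^sup>2)) +
      (\<Sum>x\<in>S. \<Sum>y\<in>S. b x y * ((\<eta> y - \<eta> x)\<^sup>2 * (v y)\<^sup>2))) / 4"
    unfolding sum.distrib[symmetric] sum_divide_distrib
    by (intro sum.cong refl) (simp add: algebra_simps)
  also have "(\<Sum>x\<in>S. \<Sum>y\<in>S. b x y * ((\<eta> y - \<eta> x)\<^sup>2 * (v y)\<^sup>2)) =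
      (\<Sum>x\<in>S. \<Sum>y\<in>S. b y x * ((\<eta> x - \<eta> y)\<^sup>2 * (v x)\<^sup>2))"
    by (rule sum.swap)
  also have "\<dots> = (\<Sum>x\<in>S. \<Sum>y\<in>S. b x y * ((\<eta> y - \<eta> x)\<^sup>2 * (v x)\<^sup>2))"
    by (intro sum.cong refl, subst b_sym) (simp add: power2_commute)
  also have "((\<Sum>x\<in>S. \<Sum>y\<in>S. b x y * ((\<eta> y - \<eta> x)\<^sup>2 * (v x)\<^sup>2)) +
      (\<Sum>x\<in>S. \<Sum>y\<in>S. b x y * ((\<eta> y - \<eta> x)\<^sup>2 * (v x)\<^sup>2))) / 4 =
      (\<Sum>x\<in>S. (v x)\<^sup>2 * (\<Sum>y\<in>S. b x y * (\<eta> y - \<eta> x)\<^sup>2) / 2)"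
    by (simp add: sum_distrib_left sum_divide_distrib[symmetric] mult_ac)
  also have "\<dots> \<le> (\<Sum>x\<in>S. \<epsilon> * (m x * (v x)\<^sup>2))"
  proof (rule sum_mono)
    fix x
    \<comment> \<open>Adding the neighbours outside \<open>S\<close> can only increase the sum and
      completes it to \<open>2 * m x * Gam \<eta> \<eta> x\<close>.\<close>
    have "(\<Sum>y\<in>S. b x y * (\<eta> y - \<eta> x)\<^sup>2) \<le> (\<Sum>y\<in>S \<union> nbrs x. b x y * (\<eta> y - \<eta> x)\<^sup>2)"
      using S finite_nbrs[of x] b_nonneg by (intro sum_mono2) auto
    also have "\<dots> = 2 * m x * Gam \<eta> \<eta> x"
      unfolding mult_Gam power2_eq_square
      by (rule sum_nbrs_eq[symmetric]) (use S finite_nbrs[of x] in auto)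
    also have "\<dots> \<le> 2 * m x * \<epsilon>"
      using assms(5) m_pos[of x] by (intro mult_left_mono) auto
    finally have "(v x)\<^sup>2 * (\<Sum>y\<in>S. b x y * (\<eta> y - \<eta> x)\<^sup>2) \<le> (v x)\<^sup>2 * (2 * m x * \<epsilon>)"
      by (intro mult_left_mono) auto
    then show "(v x)\<^sup>2 * (\<Sum>y\<in>S. b x y * (\<eta> y - \<eta> x)\<^sup>2) / 2 \<le> \<epsilon> * (m x * (v x)\<^sup>2)"
      by (simp add: mult_ac)
  qed
  also have "\<dots> \<le> \<epsilon> * M"
    unfolding sum_distrib_left[symmetric] using assms(6)[OF S] eps by (rule mult_left_mono)
  finally show ?thesis .
qed

text \<open>In \<open>caccioppoli\<close> with the completeness cutoffs, the left side tends to
  \<open>c * (m x * (v x)^2)\<close>, while \<open>M\<close> stays fixed and \<epsilon> is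
  arbitrary.\<close>

lemma subsolution_eq_0:
  assumes "complete_graph m b" "c > 0" "\<And>x. v x \<ge> 0" "\<And>x. Lap v x \<ge> c * v x"
    and M: "\<And>F. finite F \<Longrightarrow> (\<Sum>x\<in>F. m x * (v x)\<^sup>2) \<le> M"
  shows "v x = 0"
proof -
  obtain \<eta> where fin: "\<And>k. finite {x. \<eta> k x \<noteq> (0 :: real)}"
    and lim: "\<And>x. (\<lambda>k. \<eta> k x) \<longlonglongrightarrow> 1"
    and unif: "uniform_limit UNIV (\<lambda>k. Gam (\<eta> k) (\<eta> k)) (\<lambda>x. 0) sequentially"
    using assms(1) unfolding complete_graph_def One_nat_def by blast
  have M0: "M \<ge> 0" using M[of "{}"] by simp
  have bound: "c * (m x * (1 * v x)\<^sup>2) \<le> \<epsilon> * M" if "\<epsilon> > 0" for \<epsilon>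
  proof (rule tendsto_upperbound)
    show "(\<lambda>k. c * (m x * (\<eta> k x * v x)\<^sup>2)) \<longlonglongrightarrow> c * (m x * (1 * v x)\<^sup>2)"
      by (intro tendsto_intros lim)
    show "\<forall>\<^sub>F k in sequentially. c * (m x * (\<eta> k x * v x)\<^sup>2) \<le> \<epsilon> * M"
      using uniform_limitD[OF unif that]
    proof eventually_elim
      case (elim k)
      show ?case
      proof (rule caccioppoli[OF less_imp_le[OF assms(2)] assms(3,4) fin _ M])
        show "Gam (\<eta> k) (\<eta> k) x \<le> \<epsilon>" for x
          using elim[rule_format, OF UNIV_I, of x] by (simp add: dist_real_def)
      qed
    qed
  qed simp
  have "c * (m x * (v x)\<^sup>2) \<le> 0 + \<epsilon>" if "\<epsilon> > 0" for \<epsilon>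
  proof -
    \<comment> \<open>Dividing by \<open>M + 1\<close> instead of \<open>M\<close> covers
      \<open>M = 0\<close>.\<close>
    have "c * (m x * (v x)\<^sup>2) \<le> \<epsilon> / (M + 1) * M"
      using bound[of "\<epsilon> / (M + 1)"] that M0 by simp
    also have "\<dots> \<le> \<epsilon>" using that M0 by (simp add: field_simps)
    finally show ?thesis by simp
  qed
  then have "c * (m x * (v x)\<^sup>2) \<le> 0" by (rule field_le_epsilon)
  moreover have "c * m x > 0" using assms(2) m_pos[of x] by simp
  ultimately show ?thesis
    by (metis mult.assoc mult_le_0_iff not_less power2_less_eq_zero_iff)
qed

text \<open>Ellipticity turns the L^1 bound \<open>B\<close> into the sup bound
  \<open>C * B / c\<close>, because \<open>c * v x\<close> is dominated by a weighted sum of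
  \<open>v\<close> over the neighbours. Both bounds together make \<open>v\<close> square
  summable.\<close>

lemma integrable_subsolution_eq_0:
  assumes "complete_graph m b" "elliptic m b" "c > 0"
    and v0: "\<And>x. v x \<ge> 0" and v: "\<And>x. Lap v x \<ge> c * v x"
    and B: "\<And>F. finite F \<Longrightarrow> (\<Sum>x\<in>F. m x * v x) \<le> B"
  shows "v x = 0"
proof -
  obtain C where C: "C > 0" "\<And>x y. b x y \<le> C * m x * m y"
    using assms(2) unfolding elliptic_def by blast
  have bound: "v x \<le> C * B / c" for x
  proof -
    have "m x * (c * v x) \<le> m x * Lap v x"
      using v[of x] m_pos[of x] by (intro mult_left_mono) auto
    also have "\<dots> \<le> (\<Sum>y\<in>nbrs x. b x y * v y)"
      using v0[of x] deg_nonneg[of x] by (simp add: mult_Lap_deg)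
    also have "\<dots> \<le> (\<Sum>y\<in>nbrs x. C * m x * m y * v y)"
      by (intro sum_mono mult_right_mono C v0)
    also have "\<dots> = C * m x * (\<Sum>y\<in>nbrs x. m y * v y)"
      by (simp add: sum_distrib_left mult_ac)
    also have "\<dots> \<le> C * m x * B"
      using C(1) m_pos[of x] B[OF finite_nbrs[of x]] by (intro mult_left_mono) auto
    finally have "m x * (c * v x) \<le> m x * (C * B)" by (simp add: mult_ac)
    then show ?thesis using m_pos[of x] assms(3) by (simp add: field_simps)
  qed
  have "(\<Sum>x\<in>F. m x * (v x)\<^sup>2) \<le> C * B / c * B" if "finite F" for F
  proof -
    have "(\<Sum>x\<in>F. m x * (v x)\<^sup>2) \<le> (\<Sum>x\<in>F. C * B / c * (m x * v x))"
    proof (rule sum_mono)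
      fix x
      have "m x * v x * v x \<le> m x * v x * (C * B / c)"
        using bound v0 m_pos[of x] by (intro mult_left_mono) auto
      then show "m x * (v x)\<^sup>2 \<le> C * B / c * (m x * v x)"
        by (simp add: power2_eq_square mult_ac)
    qed
    also have "\<dots> \<le> C * B / c * B"
      unfolding sum_distrib_left[symmetric]
      using B[OF that] B[of "{}"] C(1) assms(3) by (intro mult_left_mono) auto
    finally show ?thesis .
  qed
  from subsolution_eq_0[OF assms(1,3) v0 v this] show ?thesis .
qed

section \<open>The resolvent equation\<close>

text \<open>The operator whose iterates, started at \<open>0\<close>, increase to the minimal solution of
  \<open>\<alpha> u - \<Delta> u = f\<close>.\<close>

definition res_step :: "real \<Rightarrow> ('a \<Rightarrow> real) \<Rightarrow> ('a \<Rightarrow> real) \<Rightarrow> 'a \<Rightarrow> real" where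
  "res_step \<alpha> f u x = (m x * f x + (\<Sum>y\<in>nbrs x. b x y * u y)) / (\<alpha> * m x + deg x)"

lemma res_denom_pos: "\<alpha> > 0 \<Longrightarrow> \<alpha> * m x + deg x > 0"
  using m_pos[of x] deg_nonneg[of x] by (simp add: add_pos_nonneg)

lemma res_step_mono: "\<alpha> > 0 \<Longrightarrow> (\<And>x. u x \<le> v x) \<Longrightarrow> res_step \<alpha> f u x \<le> res_step \<alpha> f v x"
  unfolding res_step_def using res_denom_pos[of \<alpha> x]
  by (intro divide_right_mono add_left_mono sum_mono mult_left_mono b_nonneg) auto

text \<open>Multiplying by the positive denominator \<open>\<alpha> * m x + deg x\<close> translates
  the two inequalities into the subsolution and supersolution conditions, so fixed points are
  solutions.\<close>

lemma res_step_le_iff: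
  assumes "\<alpha> > 0"
  shows "u x \<le> res_step \<alpha> f u x \<longleftrightarrow> \<alpha> * u x - Lap u x \<le> f x"
    and "res_step \<alpha> f u x \<le> u x \<longleftrightarrow> f x \<le> \<alpha> * u x - Lap u x"
proof -
  have *: "m x * (\<alpha> * u x - Lap u x) = u x * (\<alpha> * m x + deg x) - (\<Sum>y\<in>nbrs x. b x y * u y)"
    using mult_Lap_deg[of x u] by (simp add: algebra_simps)
  have "u x \<le> res_step \<alpha> f u x \<longleftrightarrow> m x * (\<alpha> * u x - Lap u x) \<le> m x * f x"
    unfolding * res_step_def using res_denom_pos[OF assms, of x]
    by (simp add: pos_le_divide_eq) linarith
  then show "u x \<le> res_step \<alpha> f u x \<longleftrightarrow> \<alpha> * u x - Lap u x \<le> f x"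
    using m_pos[of x] by simp
  have "res_step \<alpha> f u x \<le> u x \<longleftrightarrow> m x * f x \<le> m x * (\<alpha> * u x - Lap u x)"
    unfolding * res_step_def using res_denom_pos[OF assms, of x]
    by (simp add: pos_divide_le_eq) linarith
  then show "res_step \<alpha> f u x \<le> u x \<longleftrightarrow> f x \<le> \<alpha> * u x - Lap u x"
    using m_pos[of x] by simp
qed

text \<open>The subsolution inequality is tested with \<open>u\<close> itself; Green's formula turns
  \<open>- u * Lap u\<close> into the Dirichlet energy.\<close>

lemma energy_le:
  assumes "finite {x. u x \<noteq> 0}" "finite F" "\<alpha> \<ge> 0"
    and "\<And>x. 0 \<le> u x" "\<And>x. \<alpha> * u x - Lap u x \<le> f x"
  obtains S where "finite S"
    "(\<Sum>x\<in>F. m x * (\<alpha> * (u x)\<^sup>2 + Gam u u x)) \<le> (\<Sum>x\<in>S. m x * (u x * f x))"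
proof
  \<comment> \<open>The neighbours of \<open>F\<close> are included so that \<open>Gam u u\<close>
    on \<open>F\<close> becomes a sum over \<open>S\<close>.\<close>
  define S where
    "S = {x. u x \<noteq> 0} \<union> (\<Union>x\<in>{x. u x \<noteq> 0}. nbrs x) \<union> F \<union> (\<Union>x\<in>F. nbrs x)"
  show S: "finite S" using assms(1,2) finite_nbrs by (auto simp: S_def)
  have FS: "F \<subseteq> S" and nF: "\<And>x. x \<in> F \<Longrightarrow> nbrs x \<subseteq> S" by (auto simp: S_def)
  have sq: "b x y * ((u y - u x) * (u y - u x)) \<ge> 0" for x y
    using b_nonneg by simp
  have "(\<Sum>x\<in>F. m x * Gam u u x) = (\<Sum>x\<in>F. \<Sum>y\<in>S. b x y * ((u y - u x) * (u y - u x))) / 2"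
    unfolding sum_divide_distrib
  proof (rule sum.cong[OF refl])
    fix x assume "x \<in> F"
    then have "2 * m x * Gam u u x = (\<Sum>y\<in>S. b x y * ((u y - u x) * (u y - u x)))"
      unfolding mult_Gam by (intro sum_nbrs_eq S nF)
    then show "m x * Gam u u x = (\<Sum>y\<in>S. b x y * ((u y - u x) * (u y - u x)) / 2)"
      unfolding sum_divide_distrib[symmetric] by simp
  qed
  also have "\<dots> \<le> (\<Sum>x\<in>S. \<Sum>y\<in>S. b x y * ((u y - u x) * (u y - u x))) / 2"
    by (intro divide_right_mono sum_mono2 S FS sum_nonneg sq) simp
  also have "\<dots> = - (\<Sum>x\<in>S. m x * (u x * Lap u x))"
    by (subst green[OF S]) (auto simp: S_def)
  finally have "(\<Sum>x\<in>F. m x * Gam u u x) \<le> - (\<Sum>x\<in>S. m x * (u x * Lap u x))" .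
  moreover have "(\<Sum>x\<in>F. m x * (\<alpha> * (u x)\<^sup>2)) \<le> (\<Sum>x\<in>S. m x * (\<alpha> * (u x)\<^sup>2))"
    using assms(3) m_nonneg by (intro sum_mono2 S FS) auto
  ultimately have "(\<Sum>x\<in>F. m x * (\<alpha> * (u x)\<^sup>2 + Gam u u x))
      \<le> (\<Sum>x\<in>S. m x * (\<alpha> * (u x)\<^sup>2)) - (\<Sum>x\<in>S. m x * (u x * Lap u x))"
    by (simp only: distrib_left sum.distrib)
  also have "\<dots> = (\<Sum>x\<in>S. m x * (u x * (\<alpha> * u x - Lap u x)))"
    unfolding sum_subtractf[symmetric]
    by (intro sum.cong refl) (simp add: power2_eq_square algebra_simps)
  also have "\<dots> \<le> (\<Sum>x\<in>S. m x * (u x * f x))"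
    by (intro sum_mono mult_left_mono assms(4,5) m_nonneg)
  finally show "(\<Sum>x\<in>F. m x * (\<alpha> * (u x)\<^sup>2 + Gam u u x)) \<le> (\<Sum>x\<in>S. m x * (u x * f x))" .
qed

lemma tendsto_Lap:
  assumes "\<And>x. (\<lambda>n. u n x) \<longlonglongrightarrow> v x"
  shows "(\<lambda>n. Lap (u n) x) \<longlonglongrightarrow> Lap v x"
  unfolding laplacian_def by (intro tendsto_intros assms)

lemma tendsto_Gam:
  assumes "\<And>x. (\<lambda>n. u n x) \<longlonglongrightarrow> v x"
  shows "(\<lambda>n. Gam (u n) (u n) x) \<longlonglongrightarrow> Gam v v x"
  unfolding Gamma_iter.simps by (intro tendsto_intros tendsto_Lap assms) simp

text \<open>Monotone iteration from \<open>0\<close>: the iterates are increasing, finitely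
  supported subsolutions below \<open>1 / \<alpha>\<close>. Their limit is a fixed point by
  continuity, and the energy bound survives because it is uniform in \<open>n\<close> and involves
  finite sums only.\<close>

lemma resolvent_exists:
  assumes lam: "\<alpha> > 0" and f: "\<And>x. 0 \<le> f x" "\<And>x. f x \<le> 1" "finite {x. f x \<noteq> 0}"
  obtains u where "\<And>x. Lap u x = \<alpha> * u x - f x"
    "\<And>F. finite F \<Longrightarrow>
      (\<Sum>x\<in>F. m x * (\<alpha> * (u x)\<^sup>2 + Gam u u x)) \<le> (\<Sum>x | f x \<noteq> 0. m x * f x) / \<alpha>"
proof -
  define U where "U n = (res_step \<alpha> f ^^ n) (\<lambda>x. 0)" for n
  have U0: "U 0 x = 0" and USuc: "U (Suc n) x = res_step \<alpha> f (U n) x" for n x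
    by (auto simp: U_def)
  have inc: "U n x \<le> U (Suc n) x" for n x
  proof (induction n arbitrary: x)
    case 0
    then show ?case unfolding USuc U0 res_step_def
      using res_denom_pos[OF lam, of x] m_pos[of x] f(1)[of x] by (simp add: U0)
  next
    case (Suc n)
    then show ?case unfolding USuc[of "Suc n"] USuc[of n] by (intro res_step_mono lam) (simp add: USuc)
  qed
  have U_nonneg: "U n x \<ge> 0" for n x
  proof (induction n)
    case (Suc n)
    then show ?case using inc[of n x] by linarith
  qed (simp add: U0)
  have U_le: "U n x \<le> 1 / \<alpha>" for n x
  proof (induction n arbitrary: x)
    case 0
    then show ?case using lam by (simp add: U0)
  next
    case (Suc n)
    have "U (Suc n) x \<le> res_step \<alpha> f (\<lambda>_. 1 / \<alpha>) x"
      unfolding USuc by (intro res_step_mono lam Suc)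
    \<comment> \<open>The constant \<open>1 / \<alpha>\<close> is a supersolution since its
      Laplacian vanishes and \<open>f \<le> 1\<close>.\<close>
    also have "\<dots> \<le> 1 / \<alpha>"
      by (subst res_step_le_iff(2)[OF lam, where u = "\<lambda>_. 1 / \<alpha>"])
        (use lam f(2)[of x] in \<open>simp add: laplacian_def\<close>)
    finally show ?case .
  qed
  have U_fin: "finite {x. U n x \<noteq> 0}" for n
  proof (induction n)
    case (Suc n)
    have "{x. U (Suc n) x \<noteq> 0} \<subseteq> {x. f x \<noteq> 0} \<union> (\<Union>y\<in>{x. U n x \<noteq> 0}. nbrs y)"
    proof (intro subsetI, rule ccontr)
      fix x assume x: "x \<in> {x. U (Suc n) x \<noteq> 0}"
        "x \<notin> {x. f x \<noteq> 0} \<union> (\<Union>y\<in>{x. U n x \<noteq> 0}. nbrs y)"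
      then have "(\<Sum>y\<in>nbrs x. b x y * U n y) = 0"
        by (intro sum.neutral) (use b_sym in fastforce)
      with x show False by (simp add: USuc res_step_def)
    qed
    then show ?case
      by (rule finite_subset) (use Suc f(3) finite_nbrs in auto)
  qed (simp add: U0)
  have U_sub: "\<alpha> * U n x - Lap (U n) x \<le> f x" for n x
    using inc[of n x] unfolding USuc res_step_le_iff(1)[OF lam] .
  define u where "u x = lim (\<lambda>n. U n x)" for x
  have lim: "(\<lambda>n. U n x) \<longlonglongrightarrow> u x" for x
  proof -
    have "incseq (\<lambda>n. U n x)" by (intro incseq_SucI inc)
    then have "convergent (\<lambda>n. U n x)"
      using U_le incseq_convergent[of "\<lambda>n. U n x" "1 / \<alpha>"] unfolding convergent_def by blast
    then show ?thesis unfolding u_def by (simp add: convergent_LIMSEQ_iff)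
  qed
  show ?thesis
  proof
    fix x
    have "(\<lambda>n. U (Suc n) x) \<longlonglongrightarrow> u x" using lim by (rule LIMSEQ_Suc)
    moreover have "(\<lambda>n. U (Suc n) x) \<longlonglongrightarrow> res_step \<alpha> f u x"
      unfolding USuc res_step_def using res_denom_pos[OF lam, of x]
      by (intro tendsto_intros lim) auto
    ultimately have "u x = res_step \<alpha> f u x" by (rule LIMSEQ_unique)
    then show "Lap u x = \<alpha> * u x - f x"
      using res_step_le_iff(1)[OF lam, of u x f] res_step_le_iff(2)[OF lam, of f u x] by simp
  next
    fix F :: "'a set" assume F: "finite F"
    show "(\<Sum>x\<in>F. m x * (\<alpha> * (u x)\<^sup>2 + Gam u u x)) \<le> (\<Sum>x | f x \<noteq> 0. m x * f x) / \<alpha>"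
    proof (rule tendsto_upperbound)
      show "(\<lambda>n. \<Sum>x\<in>F. m x * (\<alpha> * (U n x)\<^sup>2 + Gam (U n) (U n) x))
          \<longlonglongrightarrow> (\<Sum>x\<in>F. m x * (\<alpha> * (u x)\<^sup>2 + Gam u u x))"
        by (intro tendsto_intros lim tendsto_Gam)
      show "\<forall>\<^sub>F n in sequentially. (\<Sum>x\<in>F. m x * (\<alpha> * (U n x)\<^sup>2 + Gam (U n) (U n) x))
          \<le> (\<Sum>x | f x \<noteq> 0. m x * f x) / \<alpha>"
      proof (intro always_eventually allI)
        fix n
        obtain S where S: "finite S" "(\<Sum>x\<in>F. m x * (\<alpha> * (U n x)\<^sup>2 + Gam (U n) (U n) x))
            \<le> (\<Sum>x\<in>S. m x * (U n x * f x))"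
          using energy_le[OF U_fin F less_imp_le[OF lam] U_nonneg U_sub] .
        note S(2)
        \<comment> \<open>The bound \<open>U n \<le> 1 / \<alpha>\<close> and the vanishing of
          \<open>f\<close> off its support remove the dependence on \<open>n\<close> and
          \<open>S\<close>.\<close>
        also have "(\<Sum>x\<in>S. m x * (U n x * f x)) \<le> (\<Sum>x\<in>S. m x * (1 / \<alpha> * f x))"
          by (intro sum_mono mult_left_mono mult_right_mono m_nonneg f(1) U_le)
        also have "\<dots> \<le> (\<Sum>x\<in>S \<union> {x. f x \<noteq> 0}. m x * (1 / \<alpha> * f x))"
          using S(1) f m_nonneg lam by (intro sum_mono2) auto
        also have "\<dots> = (\<Sum>x | f x \<noteq> 0. m x * (1 / \<alpha> * f x))"
          using S(1) f(3) by (intro sum.mono_neutral_right) auto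
        also have "\<dots> = (\<Sum>x | f x \<noteq> 0. m x * f x) / \<alpha>"
          by (simp add: sum_divide_distrib)
        finally show "(\<Sum>x\<in>F. m x * (\<alpha> * (U n x)\<^sup>2 + Gam (U n) (U n) x))
            \<le> (\<Sum>x | f x \<noteq> 0. m x * f x) / \<alpha>" .
      qed
    qed simp
  qed
qed

section \<open>Curvature and the gradient bound\<close>

text \<open>After the equation is inserted into the definition of the second iterate, the \<alpha>
  term has a favourable sign, and \<open>Gam_young\<close> with \<open>c = K\<close> absorbs the
  cross term \<open>Gam u f\<close>.\<close>

lemma Lap_Gam_resolvent:
  assumes "satisfies_CD_infinity m b K" "K > 0" "\<alpha> \<ge> 0"
    and "\<And>x. Lap u x = \<alpha> * u x - f x"
  shows "Lap (Gam u u) x \<ge> K * Gam u u x - Gam f f x / K"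
proof -
  have Lu: "Lap u = (\<lambda>x. \<alpha> * u x - f x)" using assms(4) by auto
  have "2 * Gamma_iter m b 2 u u x = Lap (Gam u u) x - Gam u (Lap u) x - Gam (Lap u) u x"
    by (simp add: numeral_2_eq_2 Gamma_iter.simps(2)[of m b "Suc 0"])
  also have "\<dots> = Lap (Gam u u) x - 2 * (\<alpha> * Gam u u x) + 2 * Gam u f x"
    unfolding Gam_sym[of "Lap u"] unfolding Lu Gam_linear_right by simp
  finally have "2 * (K * Gam u u x)
      \<le> Lap (Gam u u) x - 2 * (\<alpha> * Gam u u x) + 2 * Gam u f x"
    using assms(1) unfolding satisfies_CD_infinity_def One_nat_def by (metis mult_left_mono zero_le_numeral)
  moreover have "\<alpha> * Gam u u x \<ge> 0" using assms(3) Gam_nonneg by simp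
  ultimately show ?thesis using Gam_young[OF assms(2), of u f x] by linarith
qed

text \<open>The excess of \<open>Gam u u\<close> over \<open>G / K^2\<close> is an integrable
  subsolution, hence zero. The conclusion does not involve \<open>B\<close>, which may therefore
  blow up as \<alpha> tends to 0.\<close>

lemma Gam_resolvent_le:
  assumes "satisfies_CD_infinity m b K" "K > 0" "complete_graph m b" "elliptic m b" "\<alpha> \<ge> 0"
    and u: "\<And>x. Lap u x = \<alpha> * u x - f x"
    and G: "\<And>x. Gam f f x \<le> G"
    and B: "\<And>F. finite F \<Longrightarrow> (\<Sum>x\<in>F. m x * Gam u u x) \<le> B"
  shows "Gam u u x \<le> G / K\<^sup>2"
proof -
  \<comment> \<open>The threshold is the zero of \<open>K * t - G / K\<close> in
    \<open>t\<close>.\<close>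
  define v where "v x = max 0 (Gam u u x - G / K\<^sup>2)" for x
  have G0: "G \<ge> 0" using G[of x] Gam_nonneg[of f x] by simp
  have v_le: "v x \<le> Gam u u x" for x
    unfolding v_def using G0 Gam_nonneg[of u x] by simp
  have v_sub: "Lap v x \<ge> K * v x" for x
  proof (cases "Gam u u x \<le> G / K\<^sup>2")
    case True
    then have "v x = 0" by (simp add: v_def)
    \<comment> \<open>A nonnegative function has nonnegative Laplacian at its zeros.\<close>
    moreover have "m x * Lap v x \<ge> 0"
      unfolding mult_Lap_deg \<open>v x = 0\<close>
      by (auto intro!: sum_nonneg mult_nonneg_nonneg b_nonneg simp: v_def)
    ultimately show ?thesis using m_pos[of x] by (simp add: zero_le_mult_iff)
  next
    case False
    then have vx: "v x = Gam u u x - G / K\<^sup>2" by (simp add: v_def)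
    have "Gam f f x / K \<le> G / K" using G[of x] assms(2) by (simp add: divide_right_mono)
    then have "K * v x \<le> K * Gam u u x - Gam f f x / K"
      unfolding vx using assms(2) by (simp add: power2_eq_square right_diff_distrib)
    also have "\<dots> \<le> Lap (Gam u u) x"
      by (rule Lap_Gam_resolvent[OF assms(1,2,5) u])
    finally have "m x * (K * v x) \<le> m x * Lap (Gam u u) x"
      using m_pos[of x] by (intro mult_left_mono) auto
    also have "\<dots> \<le> m x * Lap v x"
      unfolding mult_Lap
    proof (intro sum_mono mult_left_mono b_nonneg)
      fix y
      \<comment> \<open>\<open>v\<close> dominates the shifted \<open>Gam u u\<close> everywhere and
        equals it at \<open>x\<close>.\<close>
      show "Gam u u y - Gam u u x \<le> v y - v x" unfolding vx by (simp add: v_def)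
    qed
    finally show ?thesis using m_pos[of x] by simp
  qed
  have v_int: "(\<Sum>x\<in>F. m x * v x) \<le> B" if "finite F" for F
  proof -
    have "(\<Sum>x\<in>F. m x * v x) \<le> (\<Sum>x\<in>F. m x * Gam u u x)"
      by (intro sum_mono mult_left_mono v_le m_nonneg)
    also have "\<dots> \<le> B" using B that .
    finally show ?thesis .
  qed
  have "v x = 0"
    by (rule integrable_subsolution_eq_0[OF assms(3,4,2) _ v_sub v_int]) (simp_all add: v_def)
  then show ?thesis unfolding v_def by linarith
qed

section \<open>Bounding the measure\<close>

text \<open>\<open>Gam_ge_edge\<close> bounds the increment over each edge in terms of
  \<open>L\<close>; adding these bounds along a path from \<open>x\<close> to \<open>z\<close> gives
  a \<open>D\<close> that is the same for all \<open>u\<close>.\<close>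

lemma oscillation_bound:
  assumes "connected_graph b"
  shows "\<exists>D\<ge>0. \<forall>u. (\<forall>y. Gam u u y \<le> L) \<longrightarrow> u z - u x \<le> D"
proof -
  obtain N p where p: "p 0 = x" "p N = z" "\<forall>i\<in>{1..N::nat}. b (p (i - 1)) (p i) > 0"
    using assms unfolding connected_graph_def by blast
  have "\<exists>D\<ge>0. \<forall>u. (\<forall>x. Gam u u x \<le> L) \<longrightarrow> u (p n) - u x \<le> D" if "n \<le> N" for n
    using that
  proof (induction n)
    case 0
    then show ?case using p(1) by auto
  next
    case (Suc n)
    then obtain D where D: "D \<ge> 0" "\<And>u. (\<forall>x. Gam u u x \<le> L) \<Longrightarrow> u (p n) - u x \<le> D"
      by auto
    let ?x = "p n" and ?y = "p (Suc n)"
    have b: "b ?x ?y > 0" using p(3) Suc.prems by (auto dest!: bspec[of _ _ "Suc n"])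
    \<comment> \<open>The absolute value keeps \<open>E\<close> nonnegative for either sign of
      \<open>L\<close>.\<close>
    define E where "E = sqrt (2 * m ?x * \<bar>L\<bar> / b ?x ?y)"
    have "u ?y - u x \<le> D + E" if u: "\<forall>x. Gam u u x \<le> L" for u
    proof -
      have "b ?x ?y * (u ?y - u ?x)\<^sup>2 \<le> 2 * m ?x * Gam u u ?x" by (rule Gam_ge_edge)
      also have "\<dots> \<le> 2 * m ?x * \<bar>L\<bar>"
        using order.trans[OF u[rule_format] abs_ge_self] m_pos[of ?x]
        by (intro mult_left_mono) auto
      finally have "(u ?y - u ?x)\<^sup>2 \<le> 2 * m ?x * \<bar>L\<bar> / b ?x ?y"
        using b by (simp add: field_simps)
      then have "u ?y - u ?x \<le> E" unfolding E_def by (rule real_le_rsqrt)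
      then show ?thesis using D(2)[OF u] by linarith
    qed
    moreover have "D + E \<ge> 0" using D(1) m_pos[of ?x] b by (simp add: E_def)
    ultimately show ?case by blast
  qed
  from this[of N] p(2) show ?thesis by simp
qed

text \<open>The order of choices matters: first \<open>z\<close>, then the cutoff index
  \<open>k\<close>, then \<open>F\<close>, and only then \<alpha>. The bound \<open>64 * I\<close>
  involves neither \<open>F\<close> nor \<alpha>.\<close>

lemma finite_sum_bound:
  assumes conn: "connected_graph b" and ell: "elliptic m b" and K: "K > 0"
    and CD: "satisfies_CD_infinity m b K" and compl: "complete_graph m b"
  obtains B where "\<And>F. finite F \<Longrightarrow> (\<Sum>x\<in>F. m x) \<le> B"
proof -
  obtain \<eta> where inc: "incseq \<eta>" and \<eta>0: "\<And>k x. \<eta> k x \<ge> (0 :: real)"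
    and fin: "\<And>k. finite {x. \<eta> k x \<noteq> (0 :: real)}"
    and lim: "\<And>x. (\<lambda>k. \<eta> k x) \<longlonglongrightarrow> 1"
    and unif: "uniform_limit UNIV (\<lambda>k. Gam (\<eta> k) (\<eta> k)) (\<lambda>x. 0) sequentially"
    using compl unfolding complete_graph_def One_nat_def by blast
  have \<eta>1: "\<eta> k x \<le> 1" for k x
    using inc by (intro incseq_le[OF _ lim]) (auto simp: incseq_def le_fun_def)
  fix z :: 'a
  \<comment> \<open>\<open>G\<close> is so small that the gradient bound \<open>G / K^2\<close>
    forces the absolute value of \<open>Lap u z\<close> to be at most \<open>1 / 4\<close>. The
    \<open>+ 1\<close> in its denominator covers \<open>deg z = 0\<close>.\<close>
  obtain G where G: "G > 0" "2 * deg z * (G / K\<^sup>2) \<le> m z * (1 / 4)\<^sup>2"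
  proof
    define G where "G = m z * (1 / 4)\<^sup>2 * K\<^sup>2 / (2 * deg z + 1)"
    have d: "2 * deg z + 1 > 0" using deg_nonneg[of z] by linarith
    show "G > 0" using m_pos[of z] K d by (simp add: G_def)
    have "2 * deg z * (G / K\<^sup>2) = m z * (1 / 4)\<^sup>2 * (2 * deg z / (2 * deg z + 1))"
      using K d by (simp add: G_def)
    also have "\<dots> \<le> m z * (1 / 4)\<^sup>2 * 1"
      using m_pos[of z] d by (intro mult_left_mono) auto
    finally show "2 * deg z * (G / K\<^sup>2) \<le> m z * (1 / 4)\<^sup>2" by simp
  qed
  have "\<forall>\<^sub>F k in sequentially. \<eta> k z > 1 / 2"
    using order_tendstoD(1)[OF lim[of z], of "1 / 2"] by simp
  moreover have "\<forall>\<^sub>F k in sequentially. \<forall>x. Gam (\<eta> k) (\<eta> k) x \<le> G"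
    using uniform_limitD[OF unif G(1)]
  proof eventually_elim
    case (elim k)
    show ?case
    proof
      show "Gam (\<eta> k) (\<eta> k) x \<le> G" for x
        using elim[rule_format, OF UNIV_I, of x] by (simp add: dist_real_def)
    qed
  qed
  ultimately have "\<forall>\<^sub>F k in sequentially. \<eta> k z > 1 / 2 \<and> (\<forall>x. Gam (\<eta> k) (\<eta> k) x \<le> G)"
    by eventually_elim auto
  then obtain k where k: "\<eta> k z > 1 / 2" "\<And>x. Gam (\<eta> k) (\<eta> k) x \<le> G"
    by (auto simp: eventually_sequentially)
  define I where "I = (\<Sum>x | \<eta> k x \<noteq> 0. m x * \<eta> k x)"
  have "\<exists>u. (\<Sum>x\<in>F. m x * (\<alpha> * u x)\<^sup>2) \<le> I \<and> \<alpha> * u z \<ge> 1 / 4 \<and> (\<forall>x. Gam u u x \<le> G / K\<^sup>2)"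
    if lam: "\<alpha> > 0" and F: "finite F" for \<alpha> F
  proof -
    obtain u where u: "\<And>x. Lap u x = \<alpha> * u x - \<eta> k x"
      and en: "\<And>F. finite F \<Longrightarrow> (\<Sum>x\<in>F. m x * (\<alpha> * (u x)\<^sup>2 + Gam u u x)) \<le> I / \<alpha>"
      by (rule resolvent_exists[OF lam, of "\<eta> k", OF \<eta>0 \<eta>1 fin, folded I_def]) (rule that)
    have "(\<Sum>x\<in>F. m x * Gam u u x) \<le> I / \<alpha>" if "finite F" for F
    proof -
      have "(\<Sum>x\<in>F. m x * Gam u u x) \<le> (\<Sum>x\<in>F. m x * (\<alpha> * (u x)\<^sup>2 + Gam u u x))"
        using m_nonneg lam by (intro sum_mono mult_left_mono) auto
      also have "\<dots> \<le> I / \<alpha>" using en that .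
      finally show ?thesis .
    qed
    note grad = Gam_resolvent_le[OF CD K compl ell less_imp_le[OF lam] u k(2) this]
    have "m z * (Lap u z)\<^sup>2 \<le> 2 * deg z * Gam u u z" by (rule Lap_square_le)
    also have "\<dots> \<le> 2 * deg z * (G / K\<^sup>2)"
      using grad deg_nonneg[of z] by (intro mult_left_mono) auto
    also have "\<dots> \<le> m z * (1 / 4)\<^sup>2" by (rule G)
    finally have "(Lap u z)\<^sup>2 \<le> (1 / 4)\<^sup>2" using m_pos[of z] by simp
    then have "\<bar>Lap u z\<bar> \<le> \<bar>1 / 4\<bar>" by (simp only: abs_le_square_iff)
    then have "\<alpha> * u z \<ge> 1 / 4" using u[of z] k(1) by linarith
    \<comment> \<open>Multiplying by \<alpha> cancels the factor \<open>1 / \<alpha>\<close> of the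
      energy bound, so \<open>I\<close> is uniform in \<alpha>.\<close>
    moreover have "(\<Sum>x\<in>F. m x * (\<alpha> * u x)\<^sup>2) \<le> I"
    proof -
      have "(\<Sum>x\<in>F. m x * (\<alpha> * u x)\<^sup>2) = \<alpha> * (\<Sum>x\<in>F. m x * (\<alpha> * (u x)\<^sup>2))"
        by (simp add: sum_distrib_left power2_eq_square mult_ac)
      also have "\<dots> \<le> \<alpha> * (\<Sum>x\<in>F. m x * (\<alpha> * (u x)\<^sup>2 + Gam u u x))"
        using m_nonneg lam Gam_nonneg by (intro mult_left_mono sum_mono) auto
      also have "\<dots> \<le> \<alpha> * (I / \<alpha>)"
        using lam by (intro mult_left_mono en F) auto
      finally show ?thesis using lam by simp
    qed
    ultimately show ?thesis using grad by blast
  qed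
  note sol = this
  have "(\<Sum>x\<in>F. m x) \<le> 64 * I" if F: "finite F" for F
  proof -
    have "\<forall>x. \<exists>D. D \<ge> 0 \<and> (\<forall>u. (\<forall>y. Gam u u y \<le> G / K\<^sup>2) \<longrightarrow> u z - u x \<le> D)"
      using oscillation_bound[OF conn] by blast
    from choice[OF this] obtain D where D: "\<And>x. D x \<ge> 0"
      "\<And>x u. (\<forall>y. Gam u u y \<le> G / K\<^sup>2) \<Longrightarrow> u z - u x \<le> D x"
      by blast
    \<comment> \<open>With this choice \<open>\<alpha> * u\<close> drops from \<open>z\<close> to
      any vertex of \<open>F\<close> by at most \<open>1 / 8\<close>, so at least
      \<open>1 / 8\<close> of its value \<open>1 / 4\<close> at \<open>z\<close> remains; squaring
      gives the factor 64. The \<open>+ 1\<close> keeps the denominator positive.\<close>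
    define \<alpha> where "\<alpha> = 1 / (8 * ((\<Sum>x\<in>F. D x) + 1))"
    have sD: "(\<Sum>x\<in>F. D x) \<ge> 0" using D(1) by (simp add: sum_nonneg)
    then have lam: "\<alpha> > 0" by (simp add: \<alpha>_def)
    obtain u where u: "(\<Sum>x\<in>F. m x * (\<alpha> * u x)\<^sup>2) \<le> I" "\<alpha> * u z \<ge> 1 / 4"
      "\<forall>x. Gam u u x \<le> G / K\<^sup>2"
      using sol[OF lam F] by blast
    have "(\<Sum>x\<in>F. m x * (1 / 8)\<^sup>2) \<le> (\<Sum>x\<in>F. m x * (\<alpha> * u x)\<^sup>2)"
    proof (rule sum_mono)
      fix x assume "x \<in> F"
      then have "D x \<le> (\<Sum>x\<in>F. D x)" using F D(1) by (intro member_le_sum) auto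
      then have "u z - u x \<le> (\<Sum>x\<in>F. D x) + 1" using D(2)[OF u(3), of x] by linarith
      then have "\<alpha> * (u z - u x) \<le> \<alpha> * ((\<Sum>x\<in>F. D x) + 1)"
        using lam by (intro mult_left_mono) auto
      also have "\<dots> = 1 / 8" using sD by (simp add: \<alpha>_def)
      finally have "1 / 8 \<le> \<alpha> * u x" using u(2) by (simp add: right_diff_distrib)
      then have "(1 / 8)\<^sup>2 \<le> (\<alpha> * u x)\<^sup>2" by (rule power_mono) simp
      then show "m x * (1 / 8)\<^sup>2 \<le> m x * (\<alpha> * u x)\<^sup>2"
        using m_pos[of x] by (intro mult_left_mono) auto
    qed
    also note u(1)
    finally show ?thesis by (simp add: power2_eq_square sum_divide_distrib[symmetric])
  qed
  then show ?thesis by (rule that)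
qed

end

text \<open>Continuity from below along the finite sets of vertices with code less than
  \<open>n\<close>.\<close>

lemma emeasure_vertex_measure_bound:
  assumes "\<And>x. m x \<ge> 0" "\<And>F. finite F \<Longrightarrow> (\<Sum>x\<in>F. m x) \<le> B"
  shows "emeasure (vertex_measure m) UNIV \<le> ennreal B"
proof -
  define A where "A n = {x::'a::countable. to_nat x < n}" for n
  have fin: "finite (A n)" for n
    unfolding A_def using finite_vimageI[OF finite_lessThan inj_to_nat, of n]
    by (simp add: vimage_def)
  have "(SUP n. emeasure (vertex_measure m) (A n)) = emeasure (vertex_measure m) (\<Union>n. A n)"
    by (rule SUP_emeasure_incseq)
      (auto simp: vertex_measure_def sets_point_measure A_def incseq_def)
  also have "(\<Union>n. A n) = UNIV" by (auto simp: A_def)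
  finally have "emeasure (vertex_measure m) UNIV = (SUP n. emeasure (vertex_measure m) (A n))" ..
  also have "\<dots> \<le> ennreal B"
  proof (rule SUP_least)
    fix n
    have "emeasure (vertex_measure m) (A n) = (\<Sum>x\<in>A n. ennreal (m x))"
      unfolding vertex_measure_def by (rule emeasure_point_measure_finite2) (auto simp: fin)
    also have "\<dots> = ennreal (\<Sum>x\<in>A n. m x)" using assms(1) by (simp add: sum_ennreal)
    also have "\<dots> \<le> ennreal B" by (intro ennreal_leI assms(2) fin)
    finally show "emeasure (vertex_measure m) (A n) \<le> ennreal B" .
  qed
  finally show ?thesis .
qed

theorem theorem6p2:
  fixes m :: "'a::countable \<Rightarrow> real"
    and b :: "'a \<Rightarrow> 'a \<Rightarrow> real"
    and K :: real
  assumes "discrete_measure_space m"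
    and "locally_finite_graph b"
    and "connected_graph b"
    and "elliptic m b"
    and "K > 0"
    and "satisfies_CD_infinity m b K"
    and "complete_graph m b"
  shows "emeasure (vertex_measure m) UNIV < \<infinity>"
proof -
  interpret weighted_graph m b
    using assms(1,2) by unfold_locales (auto simp: discrete_measure_space_def locally_finite_graph_def)
  obtain B where "\<And>F. finite F \<Longrightarrow> (\<Sum>x\<in>F. m x) \<le> B"
    using finite_sum_bound[OF assms(3-7)] by blast
  then have "emeasure (vertex_measure m) UNIV \<le> ennreal B"
    using m_pos by (intro emeasure_vertex_measure_bound) (auto intro: less_imp_le)
  also have "\<dots> < \<infinity>" by simp
  finally show ?thesis .
qed

end
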